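(* Let $\lambda\ge 1$, $\mu\ge 0$, $t\in(1/2,1]$, and let $f(z)=z+\sum_{n\ge2}a_nz^n\in\sigma$ belong to the class $\mathcal{N}_\sigma^\mu(\lambda,t)$. Define $$M_1 = 16t^2\left|3(2t^2-1)(\lambda+\mu)^3-(\mu^2+3\mu+2)(3\lambda+\mu)t^2\right|(2\lambda+\mu)^2-24t\left[t^2(3\lambda+\mu)+(4t^2-1)(\lambda+\mu)(2\lambda+\mu)\right](\lambda+\mu)^2(2\lambda+\mu)-24t^2\lambda^2(\lambda+\mu)^3,$$ $$M_2 = 8t\left[t^2(2\lambda+\mu)(3\lambda+\mu)+(4t^2-1)(\lambda+\mu)(2\lambda+\mu)^2+t(2\lambda+\mu)^2(\lambda+\mu)-2t(\lambda+\mu)^2(3\lambda+\mu)\right](\lambda+\mu)^2,$$ $$K(2^-,t)=\frac{4t^2}{(2\lambda+\mu)^2}+\frac{M_1+3M_2}{6(\lambda+\mu)^4(2\lambda+\mu)^2(3\lambda+\mu)},$$ and, when $M_1<0$ and $M_2>0$, with $c_0=\sqrt{-6M_2/M_1}$, $$K(c_0,t)=\frac{4t^2}{(2\lambda+\mu)^2}-\frac{3M_2^2}{8M_1(\lambda+\mu)^4(2\lambda+\mu)^2(3\lambda+\mu)}.$$ Then $$|a_2a_4-a_3^2|\le\begin{cases}K(2^-,t), & M_1\ge0\text{ and }M_2\ge0,\\[2pt] \max\left\{\dfrac{4t^2}{(2\lambda+\mu)^2},\,K(2^-,t)\right\}, & M_1>0\text{ and }M_2<0,\\[2pt] \dfrac{4t^2}{(2\lambda+\mu)^2},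 & M_1\le0\text{ and }M_2\le0,\\[2pt] \max\left\{K(c_0,t),\,K(2^-,t)\right\}, & M_1<0\text{ and }M_2>0.\end{cases}$$
   Context: Let $\mathbb{D}=\{z\in\mathbb{C}:|z|<1\}$. The class $\sigma$ of bi-univalent functions consists of all analytic $f:\mathbb{D}\to\mathbb{C}$ of the form $f(z)=z+\sum_{n=2}^\infty a_nz^n$ such that both $f$ and its inverse $f^{-1}$ are univalent in $\mathbb{D}$ (i.e. the local inverse of $f$ at $0$ extends to a univalent analytic function on $\mathbb{D}$). The inverse has the expansion $g(w)=f^{-1}(w)=w-a_2w^2+(2a_2^2-a_3)w^3-(5a_2^3-5a_2a_3+a_4)w^4+\cdots$. Subordination: for $F,G$ analytic in $\mathbb{D}$, $F\prec G$ means there is an analytic $\omega:\mathbb{D}\to\mathbb{C}$ with $\omega(0)=0$, $|\omega(z)|<1$ and $F(z)=G(\omega(z))$ for all $z\in\mathbb{D}$. For fixed $t$ let $H(z,t)=\dfrac{1}{1-2tz+z^2}$, $z\in\mathbb{D}$. For $\lambda\ge1$, $\mu\ge0$, $t\in(1/2,1]$, a function $f\in\sigma$ is in $\mathcal{N}_\sigma^\mu(\lambda,t)$ if, with $g=f^{-1}$, $$(1-\lambda)\left(\frac{f(z)}{z}\right)^\mu+\lambda f'(z)\left(\frac{f(z)}{z}\right)^{\mu-1}\prec H(z,t)\quad\text{and}\quad(1-\lambda)\left(\frac{g(w)}{w}\right)^\mu+\lambda g'(w)\left(\frac{g(w)}{w}\right)^{\mu-1}\prec H(w,t)$$ for $z,w\in\mathbb{D}$,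 where powers denote the analytic branches equal to $1$ at the origin. *)

theory Defs
  imports "HOL-Complex_Analysis.Complex_Analysis"
begin

abbreviation unit_disc :: "complex set" where
  "unit_disc \<equiv> ball 0 1"

definition univalent :: "(complex \<Rightarrow> complex) \<Rightarrow> bool" where
  "univalent f \<longleftrightarrow> f holomorphic_on unit_disc \<and> inj_on f unit_disc"

text \<open>
  The germ condition says that \<open>g\<close> is the local inverse of \<open>f\<close> at \<open>0\<close>; it implies
  \<open>g 0 = 0\<close> when \<open>f 0 = 0\<close>. By the identity theorem the restriction of \<open>g\<close> to the unit disc
  is determined by \<open>f\<close>.
\<close>

definition univalent_inverse :: "(complex \<Rightarrow> complex) \<Rightarrow> (complex \<Rightarrow> complex) \<Rightarrow> bool" where
  "univalent_inverse f g \<longleftrightarrow> univalent g \<and> (\<forall>\<^sub>F z in nhds 0. g (f z) = z)"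

definition bi_univalent :: "(complex \<Rightarrow> complex) set" where
  "bi_univalent = {f. univalent f \<and> f 0 = 0 \<and> deriv f 0 = 1 \<and> (\<exists>g. univalent_inverse f g)}"

definition subordinate :: "(complex \<Rightarrow> complex) \<Rightarrow> (complex \<Rightarrow> complex) \<Rightarrow> bool" where
  "subordinate F G \<longleftrightarrow> (\<exists>\<omega>. \<omega> holomorphic_on unit_disc \<and> \<omega> 0 = 0 \<and>
     (\<forall>z\<in>unit_disc. cmod (\<omega> z) < 1 \<and> F z = G (\<omega> z)))"

definition chebyshev_gen :: "real \<Rightarrow> complex \<Rightarrow> complex" where
  "chebyshev_gen t z = 1 / (1 - 2 * of_real t * z + z\<^sup>2)"

text \<open>The quotient \<open>f z / z\<close>, with its removable singularity at \<open>0\<close> filled in.\<close>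

definition ratio :: "(complex \<Rightarrow> complex) \<Rightarrow> complex \<Rightarrow> complex" where
  "ratio f z = (if z = 0 then deriv f 0 else f z / z)"

definition is_log_branch :: "(complex \<Rightarrow> complex) \<Rightarrow> (complex \<Rightarrow> complex) \<Rightarrow> bool" where
  "is_log_branch h L \<longleftrightarrow> L holomorphic_on unit_disc \<and> L 0 = 0 \<and> (\<forall>z\<in>unit_disc. exp (L z) = h z)"

text \<open>
  The principal power \<open>powr\<close> would be wrong here: \<open>f z / z\<close> may cross the negative real axis.
  The analytic branch of \<open>h\<^sup>a\<close> with value \<open>1\<close> at the origin is \<open>exp (a * L)\<close>, with \<open>L\<close> the
  holomorphic logarithm of \<open>h\<close> vanishing at \<open>0\<close>. The lemmas below show that \<open>L\<close> exists for the
  functions in question and is unique on the unit disc.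
\<close>

definition branch_powr :: "(complex \<Rightarrow> complex) \<Rightarrow> real \<Rightarrow> complex \<Rightarrow> complex" where
  "branch_powr h a z = exp (of_real a * (SOME L. is_log_branch h L) z)"

lemma is_log_branch_unique:
  assumes "is_log_branch h L" "is_log_branch h L'" "z \<in> unit_disc"
  shows "L z = L' z"
proof -
  define D where "D = (\<lambda>z. L z - L' z)"
  have hol: "L holomorphic_on unit_disc" "L' holomorphic_on unit_disc"
    and D0: "D 0 = 0" and eq: "\<And>z. z \<in> unit_disc \<Longrightarrow> exp (L z) = exp (L' z)"
    using assms by (auto simp: is_log_branch_def D_def)
  have e: "exp (D z) = 1" if "z \<in> unit_disc" for z
    using eq[OF that] by (simp add: D_def exp_diff)
  have Dh: "D holomorphic_on unit_disc"
    unfolding D_def using hol by (intro holomorphic_intros)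
  have "deriv D w = 0" if w: "w \<in> unit_disc" for w
  proof -
    have d: "(D has_field_derivative deriv D w) (at w)"
      using Dh w by (intro holomorphic_derivI) auto
    have "((\<lambda>z. exp (D z)) has_field_derivative exp (D w) * deriv D w) (at w)"
      by (rule DERIV_fun_exp[OF d])
    moreover have "((\<lambda>z. exp (D z)) has_field_derivative 0) (at w)"
      using has_field_derivative_transform_within_open[of "\<lambda>_. 1" 0 w unit_disc "\<lambda>z. exp (D z)"] w e
      by auto
    ultimately show ?thesis using DERIV_unique by fastforce
  qed
  then have "(D has_field_derivative 0) (at w within unit_disc)" if "w \<in> unit_disc" for w
    using that Dh holomorphic_derivI[of D unit_disc w] has_field_derivative_at_within
    by (metis open_ball)
  then obtain c where "\<And>w. w \<in> unit_disc \<Longrightarrow> D w = c"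
    using has_field_derivative_zero_constant[of unit_disc D] convex_ball by blast
  then have "D z = D 0" using assms(3) by simp
  then show ?thesis using D0 by (simp add: D_def)
qed

lemma is_log_branch_ratio_exists:
  assumes "univalent f" "f 0 = 0" "deriv f 0 = 1"
  shows "\<exists>L. is_log_branch (ratio f) L"
proof -
  have f: "f holomorphic_on unit_disc" "inj_on f unit_disc"
    using assms by (auto simp: univalent_def)
  have h: "ratio f holomorphic_on unit_disc"
    by (rule pole_theorem_open_0[OF f(1), where a = 0]) (auto simp: ratio_def assms)
  have nz: "ratio f z \<noteq> 0" if "z \<in> unit_disc" for z
  proof (cases "z = 0")
    case False
    then have "f z \<noteq> f 0" using f(2) that by (auto dest: inj_onD)
    then show ?thesis using False assms by (simp add: ratio_def)
  qed (use assms in \<open>simp add: ratio_def\<close>)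
  obtain g where g: "g holomorphic_on unit_disc" "\<And>z. z \<in> unit_disc \<Longrightarrow> ratio f z = exp (g z)"
    using contractible_imp_holomorphic_log[OF h convex_imp_contractible[OF convex_ball] nz] by blast
  have "exp (g 0) = 1" using g(2)[of 0] assms by (simp add: ratio_def)
  then have "is_log_branch (ratio f) (\<lambda>z. g z - g 0)"
    using g unfolding is_log_branch_def by (auto intro!: holomorphic_intros simp: exp_diff)
  then show ?thesis by blast
qed

definition N_functional :: "real \<Rightarrow> real \<Rightarrow> (complex \<Rightarrow> complex) \<Rightarrow> complex \<Rightarrow> complex" where
  "N_functional \<mu> lam f z =
     (1 - of_real lam) * branch_powr (ratio f) \<mu> z
     + of_real lam * deriv f z * branch_powr (ratio f) (\<mu> - 1) z"

definition N_class :: "real \<Rightarrow> real \<Rightarrow> real \<Rightarrow> (complex \<Rightarrow> complex) set" where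
  "N_class \<mu> lam t = {f \<in> bi_univalent. \<exists>g. univalent_inverse f g \<and>
     subordinate (N_functional \<mu> lam f) (chebyshev_gen t) \<and>
     subordinate (N_functional \<mu> lam g) (chebyshev_gen t)}"

definition M1 :: "real \<Rightarrow> real \<Rightarrow> real \<Rightarrow> real" where
  "M1 \<mu> lam t =
     16 * t^2 * \<bar>3 * (2 * t^2 - 1) * (lam + \<mu>)^3 - (\<mu>^2 + 3 * \<mu> + 2) * (3 * lam + \<mu>) * t^2\<bar>
       * (2 * lam + \<mu>)^2
     - 24 * t * (t^2 * (3 * lam + \<mu>) + (4 * t^2 - 1) * (lam + \<mu>) * (2 * lam + \<mu>))
       * (lam + \<mu>)^2 * (2 * lam + \<mu>)
     - 24 * t^2 * lam^2 * (lam + \<mu>)^3"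

definition M2 :: "real \<Rightarrow> real \<Rightarrow> real \<Rightarrow> real" where
  "M2 \<mu> lam t =
     8 * t * (t^2 * (2 * lam + \<mu>) * (3 * lam + \<mu>)
              + (4 * t^2 - 1) * (lam + \<mu>) * (2 * lam + \<mu>)^2
              + t * (2 * lam + \<mu>)^2 * (lam + \<mu>)
              - 2 * t * (lam + \<mu>)^2 * (3 * lam + \<mu>))
       * (lam + \<mu>)^2"

definition K_two :: "real \<Rightarrow> real \<Rightarrow> real \<Rightarrow> real" where
  "K_two \<mu> lam t = 4 * t^2 / (2 * lam + \<mu>)^2
     + (M1 \<mu> lam t + 3 * M2 \<mu> lam t)
       / (6 * (lam + \<mu>)^4 * (2 * lam + \<mu>)^2 * (3 * lam + \<mu>))"

text \<open>
  \<open>K_two\<close> and \<open>K_c0\<close> are the values \<open>K(2\<^sup>-,t)\<close> and \<open>K(c\<^sub>0,t)\<close>, with \<open>c\<^sub>0 = sqrt (-6 M2 / M1)\<close>,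
  given in closed form. The second one is meaningful only for \<open>M1 < 0\<close> and \<open>M2 > 0\<close>.
\<close>

definition K_c0 :: "real \<Rightarrow> real \<Rightarrow> real \<Rightarrow> real" where
  "K_c0 \<mu> lam t = 4 * t^2 / (2 * lam + \<mu>)^2
     - 3 * (M2 \<mu> lam t)^2
       / (8 * M1 \<mu> lam t * (lam + \<mu>)^4 * (2 * lam + \<mu>)^2 * (3 * lam + \<mu>))"

end

theory Submission
  imports Defs
begin

text \<open>
  Write \<open>A\<close>, \<open>B\<close>, \<open>C\<close> for \<open>n * lam + \<mu>\<close> with \<open>n = 1, 2, 3\<close>, and \<open>g\<close> for the inverse of \<open>f\<close>.
  If \<open>L\<close> is the logarithm of \<open>f z / z\<close>, then \<open>f' = exp L * (1 + z * L')\<close>, so the functional of the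
  class is \<open>exp (\<mu> * L) * (1 + lam * z * L')\<close> and its first coefficients are easy to compute
  (\<open>N_functional_expansion\<close>). The two subordinations equate them with
  coefficients of \<open>chebyshev_gen t \<circ> \<omega>\<close>, where \<open>\<omega>\<close> has coefficients \<open>c\<^sub>n\<close> for \<open>f\<close> and \<open>d\<^sub>n\<close> for \<open>g\<close>.
  Since the coefficients of \<open>g\<close> are polynomials in those of \<open>f\<close>, this gives six equations. They force
  \<open>d\<^sub>1 = - c\<^sub>1\<close> and express \<open>a\<^sub>2 a\<^sub>4 - a\<^sub>3\<^sup>2\<close> as a polynomial in the \<open>c\<^sub>n\<close> and \<open>d\<^sub>n\<close> (\<open>Hankel_identity\<close>).

  Put \<open>x = |c\<^sub>1| = |d\<^sub>1|\<close>. The Schur algorithm bounds the other coefficients of a Schwarz function: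
  \<open>|c\<^sub>2| \<le> 1 - x\<^sup>2\<close> and \<open>|c\<^sub>3| \<le> 1 - x\<^sup>2 - |c\<^sub>2|\<^sup>2 / (1 + x)\<close> (\<open>Schwarz_coefficients\<close>). After the
  triangle inequality one has to maximise a quadratic in \<open>p = |c\<^sub>2|\<close> and \<open>q = |d\<^sub>2|\<close> for fixed \<open>x\<close>.
  The bound on the third coefficients contributes \<open>- (p\<^sup>2 + q\<^sup>2)\<close>, which is at most
  \<open>- (p + q)\<^sup>2 / 2\<close>; this makes the quadratic a function of \<open>p + q\<close> alone, and that function is
  increasing because \<open>B\<^sup>2 \<le> 2 A C\<close>. So the maximum is at \<open>p = q = 1 - x\<^sup>2\<close> (\<open>Hankel_estimate\<close>).

  The resulting bound is \<open>4 t\<^sup>2 / B\<^sup>2 + (M1 y\<^sup>2 + 3 M2 y) / (6 A\<^sup>4 B\<^sup>2 C)\<close> at \<open>y = x\<^sup>2\<close>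
  (\<open>Hankel_majorant_eq\<close>). With \<open>c = 2 x\<close> this is the function \<open>K(c,t)\<close>: \<open>K_two\<close> is its value at
  \<open>y = 1\<close> and \<open>K_c0\<close> its value at the vertex \<open>y = - 3 M2 / (2 M1)\<close>. The four cases of the theorem
  bound this quadratic in \<open>y\<close> on \<open>[0, 1]\<close> according to the signs of its coefficients.
\<close>

unbundle no vec_syntax
unbundle fps_syntax

section \<open>Low-order coefficients of power series\<close>

lemma fps_mult_nth_2: "(F * G) $ 2 = F $ 0 * G $ 2 + F $ 1 * G $ 1 + F $ 2 * G $ 0"
  for F G :: "'a::comm_ring_1 fps"
  by (simp add: fps_mult_nth eval_nat_numeral)

lemma fps_mult_nth_3: "(F * G) $ 3 = F $ 0 * G $ 3 + F $ 1 * G $ 2 + F $ 2 * G $ 1 + F $ 3 * G $ 0"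
  for F G :: "'a::comm_ring_1 fps"
  by (simp add: fps_mult_nth eval_nat_numeral)

lemma fps_mult_nth_4:
  "(F * G) $ 4 = F $ 0 * G $ 4 + F $ 1 * G $ 3 + F $ 2 * G $ 2 + F $ 3 * G $ 1 + F $ 4 * G $ 0"
  for F G :: "'a::comm_ring_1 fps"
  by (simp add: fps_mult_nth eval_nat_numeral)

lemmas fps_low_mult = fps_mult_nth_0 fps_mult_nth_1 fps_mult_nth_2 fps_mult_nth_3 fps_mult_nth_4

lemma has_fps_expansion_unique_on_disc:
  assumes "f has_fps_expansion F" "g has_fps_expansion G" "\<And>z. z \<in> unit_disc \<Longrightarrow> f z = g z"
  shows "F = G"
proof -
  have "eventually (\<lambda>z. z \<in> unit_disc) (nhds (0::complex))"
    by (intro eventually_nhds_in_open) auto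
  then have "eventually (\<lambda>z. f z = g z) (nhds 0)" by eventually_elim (use assms in auto)
  then have "g has_fps_expansion F" using assms(1) has_fps_expansion_cong by blast
  then show ?thesis using assms(2) fps_expansion_unique_complex by blast
qed

section \<open>Coefficients of Schwarz functions\<close>

text \<open>
  The value \<open>1\<close> is allowed for \<open>|w z / z|\<close>, as rotations attain it; hence the next lemma starts from
  functions into the closed disc.
\<close>
lemma Schwarz_quotient:
  assumes "w holomorphic_on unit_disc" "w 0 = 0" "\<And>z. z \<in> unit_disc \<Longrightarrow> cmod (w z) < 1"
  obtains p where "p holomorphic_on unit_disc" "\<And>z. z \<in> unit_disc \<Longrightarrow> w z = z * p z"
    "\<And>z. z \<in> unit_disc \<Longrightarrow> cmod (p z) \<le> 1"
proof -
  obtain p where p: "p holomorphic_on unit_disc" "\<And>z. cmod z < 1 \<Longrightarrow> w z = z * p z" "deriv w 0 = p 0"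
    using Schwarz3[OF assms(1,2)] by blast
  have "cmod (p z) \<le> 1" if z: "cmod z < 1" for z
  proof (cases "z = 0")
    case True
    then show ?thesis using Schwarz_Lemma(2)[OF assms(1,2) _ z] assms(3) p(3) by simp
  next
    case False
    then show ?thesis using Schwarz_Lemma(1)[OF assms(1,2) _ z] assms(3) p(2)[OF z]
      by (simp add: norm_mult)
  qed
  then show ?thesis using p by (intro that[of p]) auto
qed

text \<open>
  One step of the Schur algorithm. Composing \<open>p\<close> with the disc automorphism that sends \<open>p 0\<close> to \<open>0\<close>
  gives a Schwarz function \<open>z * s z\<close>, and \<open>s\<close> is again bounded by \<open>1\<close>. The conclusion is free of
  division, which makes coefficients easy to compare and also covers the degenerate case of a
  unimodular constant, where \<open>q = s = 0\<close>.
\<close>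
lemma Schur_step:
  assumes hol: "p holomorphic_on unit_disc" and le: "\<And>z. z \<in> unit_disc \<Longrightarrow> cmod (p z) \<le> 1"
  obtains q s where "q holomorphic_on unit_disc" "s holomorphic_on unit_disc"
    "\<And>z. z \<in> unit_disc \<Longrightarrow> cmod (s z) \<le> 1"
    "\<And>z. z \<in> unit_disc \<Longrightarrow> p z = p 0 + z * q z"
    "\<And>z. z \<in> unit_disc \<Longrightarrow> q z = (1 - cnj (p 0) * p z) * s z"
proof (cases "\<exists>u\<in>unit_disc. cmod (p u) = 1")
  case True
  then obtain u where u: "u \<in> unit_disc" "cmod (p u) = 1" by blast
  have "p constant_on unit_disc"
    by (rule maximum_modulus_principle[OF hol _ _ _ _ u(1)]) (use le u in auto)
  then obtain k where "\<And>z. z \<in> unit_disc \<Longrightarrow> p z = k" by (auto simp: constant_on_def)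
  then show ?thesis by (intro that[of "\<lambda>_. 0" "\<lambda>_. 0"]) auto
next
  case False
  then have lt: "cmod (p z) < 1" if "z \<in> unit_disc" for z using le that by fastforce
  have lt0: "cmod (p 0) < 1" using lt[of 0] by simp
  define w where "w = Moebius_function 0 (p 0) \<circ> p"
  have "w holomorphic_on unit_disc" unfolding w_def
    by (rule holomorphic_on_compose_gen[OF hol Moebius_function_holomorphic[OF lt0]]) (use lt in auto)
  moreover have "w 0 = 0" by (simp add: w_def Moebius_function_eq_zero)
  moreover have "cmod (w z) < 1" if "z \<in> unit_disc" for z
    using Moebius_function_norm_lt_1[OF lt0 lt[OF that]] by (simp add: w_def)
  ultimately obtain s where s: "s holomorphic_on unit_disc" "\<And>z. z \<in> unit_disc \<Longrightarrow> w z = z * s z"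
    "\<And>z. z \<in> unit_disc \<Longrightarrow> cmod (s z) \<le> 1"
    using Schwarz_quotient by metis
  have nz: "1 - cnj (p 0) * p z \<noteq> 0" if "z \<in> unit_disc" for z
  proof
    assume "1 - cnj (p 0) * p z = 0"
    then have "cmod (p 0) * cmod (p z) = 1"
      by (metis complex_mod_cnj norm_mult norm_one right_minus_eq)
    moreover have "cmod (p 0) * cmod (p z) < 1 * 1"
      by (intro mult_strict_mono') (use lt0 lt[OF that] in auto)
    ultimately show False by simp
  qed
  define q where "q = (\<lambda>z. (1 - cnj (p 0) * p z) * s z)"
  have "p z = p 0 + z * q z" if "z \<in> unit_disc" for z
  proof -
    have "(p z - p 0) / (1 - cnj (p 0) * p z) = z * s z"
      using s(2)[OF that] by (simp add: w_def Moebius_function_simple)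
    then show ?thesis using nz[OF that] by (simp add: q_def field_simps)
  qed
  moreover have "q holomorphic_on unit_disc" unfolding q_def by (intro holomorphic_intros hol s)
  ultimately show ?thesis by (intro that[of q s]) (use s in \<open>auto simp: q_def\<close>)
qed

text \<open>
  Two Schur steps parametrise the coefficients as \<open>W\<^sub>1 = p\<^sub>0\<close>, \<open>W\<^sub>2 = (1 - |p\<^sub>0|\<^sup>2) s\<^sub>0\<close> and
  \<open>W\<^sub>3 = (1 - |p\<^sub>0|\<^sup>2) ((1 - |s\<^sub>0|\<^sup>2) u\<^sub>0 - cnj p\<^sub>0 s\<^sub>0\<^sup>2)\<close>, where \<open>p\<^sub>0\<close>, \<open>s\<^sub>0\<close>, \<open>u\<^sub>0\<close> lie in the closed
  unit disc. The bound on \<open>W\<^sub>3\<close> follows by the triangle inequality, since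
  \<open>(1 - x\<^sup>2) (1 - x) v\<^sup>2 = ((1 - x\<^sup>2) v)\<^sup>2 / (1 + x)\<close> for \<open>x = |p\<^sub>0|\<close> and \<open>v = |s\<^sub>0|\<close>.
\<close>
lemma Schwarz_coefficients:
  assumes hol: "w holomorphic_on unit_disc" and w0: "w 0 = 0"
    and lt: "\<And>z. z \<in> unit_disc \<Longrightarrow> cmod (w z) < 1"
    and W: "w has_fps_expansion W"
  shows "cmod (W $ 1) \<le> 1" "cmod (W $ 2) \<le> 1 - (cmod (W $ 1))\<^sup>2"
    "cmod (W $ 3) \<le> 1 - (cmod (W $ 1))\<^sup>2 - (cmod (W $ 2))\<^sup>2 / (1 + cmod (W $ 1))"
proof -
  have ex: "f has_fps_expansion fps_expansion f 0" if "f holomorphic_on unit_disc" for f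
    using that by (intro has_fps_expansion_fps_expansion[of unit_disc]) auto
  obtain p where p: "p holomorphic_on unit_disc" "\<And>z. z \<in> unit_disc \<Longrightarrow> w z = z * p z"
    "\<And>z. z \<in> unit_disc \<Longrightarrow> cmod (p z) \<le> 1"
    using Schwarz_quotient[OF hol w0 lt] by metis
  obtain q s where q: "q holomorphic_on unit_disc" "s holomorphic_on unit_disc"
    "\<And>z. z \<in> unit_disc \<Longrightarrow> cmod (s z) \<le> 1"
    "\<And>z. z \<in> unit_disc \<Longrightarrow> p z = p 0 + z * q z"
    "\<And>z. z \<in> unit_disc \<Longrightarrow> q z = (1 - cnj (p 0) * p z) * s z"
    using Schur_step[OF p(1,3)] by metis
  obtain r u where r: "r holomorphic_on unit_disc" "u holomorphic_on unit_disc"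
    "\<And>z. z \<in> unit_disc \<Longrightarrow> cmod (u z) \<le> 1"
    "\<And>z. z \<in> unit_disc \<Longrightarrow> s z = s 0 + z * r z"
    "\<And>z. z \<in> unit_disc \<Longrightarrow> r z = (1 - cnj (s 0) * s z) * u z"
    using Schur_step[OF q(2,3)] by metis
  define P Q S R where "P = fps_expansion p 0" and "Q = fps_expansion q 0"
    and "S = fps_expansion s 0" and "R = fps_expansion r 0"
  have PQ: "p has_fps_expansion P" "q has_fps_expansion Q" "s has_fps_expansion S" "r has_fps_expansion R"
    unfolding P_def Q_def S_def R_def by (intro ex p q r)+
  note [fps_expansion_intros] = PQ
  have "W = fps_X * P"
    by (rule has_fps_expansion_unique_on_disc[OF W _ p(2)]) (intro fps_expansion_intros)
  moreover have "P = fps_const (p 0) + fps_X * Q"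
    by (rule has_fps_expansion_unique_on_disc[OF PQ(1) _ q(4)]) (intro fps_expansion_intros)
  moreover have "Q = (1 - fps_const (cnj (p 0)) * P) * S"
    by (rule has_fps_expansion_unique_on_disc[OF PQ(2) _ q(5)]) (intro fps_expansion_intros)
  moreover have "S = fps_const (s 0) + fps_X * R"
    by (rule has_fps_expansion_unique_on_disc[OF PQ(3) _ r(4)]) (intro fps_expansion_intros)
  moreover have z0: "P $ 0 = p 0" "S $ 0 = s 0" "R $ 0 = r 0"
    using PQ has_fps_expansion_imp_0_eq_fps_nth_0 by metis+
  ultimately have W_eq: "W = fps_X * P" and P_eq: "P = fps_const (p 0) + fps_X * Q"
    and Q_eq: "Q = (1 - fps_const (cnj (p 0)) * P) * S" and S_eq: "S = fps_const (s 0) + fps_X * R"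
    and z0: "P $ 0 = p 0" "S $ 0 = s 0" "R $ 0 = r 0"
    by blast+
  have W: "W $ 1 = p 0" "W $ 2 = P $ 1" "W $ 3 = P $ 2" using W_eq z0 by simp_all
  have sq: "(complex_of_real (cmod z))\<^sup>2 = z * cnj z" for z
    using complex_norm_square[of z] by simp
  have step: "(fps_const k + fps_X * H) $ 1 = H $ 0" "(fps_const k + fps_X * H) $ 2 = H $ 1"
    for k :: complex and H by (simp_all add: numeral_2_eq_2)
  have P: "P $ 1 = Q $ 0" "P $ 2 = Q $ 1" using step[of "p 0" Q] P_eq by simp_all
  have "S $ 1 = r 0" using step(1)[of "s 0" R] S_eq z0(3) by simp
  moreover have "r 0 = (1 - (cmod (s 0))\<^sup>2) * u 0"
    using r(5)[of 0] by (simp add: sq mult.commute)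
  ultimately have S1: "S $ 1 = (1 - (cmod (s 0))\<^sup>2) * u 0" by simp
  have Q0: "Q $ 0 = (1 - (cmod (p 0))\<^sup>2) * s 0"
    by (subst Q_eq) (simp add: z0 sq mult.commute)
  have Q1: "Q $ 1 = (1 - (cmod (p 0))\<^sup>2) * S $ 1 - cnj (p 0) * P $ 1 * s 0"
    by (subst Q_eq) (simp add: z0 sq algebra_simps)
  define x v where "x = cmod (p 0)" and "v = cmod (s 0)"
  have x: "0 \<le> x" "x \<le> 1" "x\<^sup>2 \<le> 1" and v: "0 \<le> v" "v \<le> 1" "v\<^sup>2 \<le> 1" and u: "cmod (u 0) \<le> 1"
    using p(3)[of 0] q(3)[of 0] r(3)[of 0] by (auto simp: x_def v_def abs_square_le_1)
  have nr: "cmod (1 - (complex_of_real y)\<^sup>2) = 1 - y\<^sup>2" if "y\<^sup>2 \<le> 1" for y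
    using norm_of_real[of "1 - y\<^sup>2", where 'a = complex] that by simp
  note nx = nr[OF x(3)] and nv = nr[OF v(3)]
  have W1: "cmod (W $ 1) = x" unfolding W x_def ..
  have W2: "cmod (W $ 2) = (1 - x\<^sup>2) * v"
    unfolding W P Q0 by (simp add: norm_mult nx flip: x_def v_def)
  have "W $ 3 = (1 - x\<^sup>2) * ((1 - v\<^sup>2) * u 0) - cnj (p 0) * W $ 2 * s 0"
    unfolding W P(2) Q1 S1 x_def v_def by simp
  then have "cmod (W $ 3) \<le> cmod ((1 - x\<^sup>2) * ((1 - v\<^sup>2) * u 0)) + cmod (cnj (p 0) * W $ 2 * s 0)"
    by (simp only: norm_triangle_ineq4)
  also have "\<dots> = (1 - x\<^sup>2) * ((1 - v\<^sup>2) * cmod (u 0)) + x * ((1 - x\<^sup>2) * v) * v"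
    by (simp add: norm_mult nx nv W2 flip: x_def v_def)
  also have "\<dots> \<le> (1 - x\<^sup>2) * ((1 - v\<^sup>2) * 1) + x * ((1 - x\<^sup>2) * v) * v"
    using x v u by (intro add_right_mono mult_left_mono) auto
  also have "\<dots> = 1 - x\<^sup>2 - ((1 - x\<^sup>2) * v)\<^sup>2 / (1 + x)"
    using x by (simp add: field_simps power2_eq_square)
  finally have W3: "cmod (W $ 3) \<le> 1 - x\<^sup>2 - ((1 - x\<^sup>2) * v)\<^sup>2 / (1 + x)" .
  have "(1 - x\<^sup>2) * v \<le> (1 - x\<^sup>2) * 1" using x v by (intro mult_left_mono) auto
  then show "cmod (W $ 1) \<le> 1" "cmod (W $ 2) \<le> 1 - (cmod (W $ 1))\<^sup>2"
    "cmod (W $ 3) \<le> 1 - (cmod (W $ 1))\<^sup>2 - (cmod (W $ 2))\<^sup>2 / (1 + cmod (W $ 1))"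
    using W3 x unfolding W1 W2 by simp_all
qed

section \<open>Coefficients imposed by membership in the class\<close>

text \<open>Comparing coefficients in \<open>E' = m * E * L'\<close> determines those of \<open>E = exp (m * L)\<close> recursively.\<close>
lemma fps_nth_exp_compose:
  fixes L :: "complex fps" and m :: complex
  assumes L0: "L $ 0 = 0"
  defines "E \<equiv> fps_exp m oo L"
  shows "E $ 0 = 1" "E $ 1 = m * L $ 1" "E $ 2 = m * L $ 2 + m\<^sup>2 * (L $ 1)\<^sup>2 / 2"
    "E $ 3 = m * L $ 3 + m\<^sup>2 * L $ 1 * L $ 2 + m ^ 3 * (L $ 1) ^ 3 / 6"
proof -
  have "fps_deriv E = fps_const m * (E * fps_deriv L)"
    unfolding E_def fps_compose_deriv[OF L0] fps_exp_deriv fps_compose_mult_distrib[OF L0]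
    by (simp add: mult.assoc)
  then have d: "fps_deriv E $ n = m * (E * fps_deriv L) $ n" for n by simp
  show E0: "E $ 0 = 1" by (simp add: E_def)
  show E1: "E $ 1 = m * L $ 1" using d[of 0] E0 by simp
  show E2: "E $ 2 = m * L $ 2 + m\<^sup>2 * (L $ 1)\<^sup>2 / 2"
    using d[of 1] E0 E1 by (simp add: fps_mult_nth_1 numeral_2_eq_2 field_simps)
  show "E $ 3 = m * L $ 3 + m\<^sup>2 * L $ 1 * L $ 2 + m ^ 3 * (L $ 1) ^ 3 / 6"
    using d[of 2] E0 E1 E2
    by (simp add: fps_mult_nth_2) (simp add: eval_nat_numeral field_simps)
qed

text \<open>
  In terms of the logarithm of \<open>f z / z\<close> the two branches of powers become exponentials, and the
  derivative of \<open>f\<close> contributes a logarithmic derivative only.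
\<close>
lemma N_functional_exp_form:
  assumes "univalent f" "f 0 = 0" "deriv f 0 = 1"
  obtains L :: "complex \<Rightarrow> complex" where "L holomorphic_on unit_disc" "L 0 = 0"
    "\<And>z. z \<in> unit_disc \<Longrightarrow> f z = z * exp (L z)"
    "\<And>z. z \<in> unit_disc \<Longrightarrow> N_functional \<mu> lam f z = exp (\<mu> * L z) * (1 + lam * (z * deriv L z))"
proof -
  define L where "L = (SOME L. is_log_branch (ratio f) L)"
  have "is_log_branch (ratio f) L"
    unfolding L_def by (rule someI_ex[OF is_log_branch_ratio_exists[OF assms]])
  then have L: "L holomorphic_on unit_disc" "L 0 = 0" "\<And>z. z \<in> unit_disc \<Longrightarrow> exp (L z) = ratio f z"
    by (auto simp: is_log_branch_def)
  have f: "f z = z * exp (L z)" if "z \<in> unit_disc" for z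
    using L(3)[OF that] assms(2) by (auto simp: ratio_def split: if_splits)
  have N: "N_functional \<mu> lam f z = exp (\<mu> * L z) * (1 + lam * (z * deriv L z))" if z: "z \<in> unit_disc" for z
  proof -
    have "(L has_field_derivative deriv L z) (at z)"
      using L(1) z by (intro holomorphic_derivI) auto
    then have "((\<lambda>z. z * exp (L z)) has_field_derivative exp (L z) * (1 + z * deriv L z)) (at z)"
      by (auto intro!: derivative_eq_intros simp: algebra_simps)
    then have "(f has_field_derivative exp (L z) * (1 + z * deriv L z)) (at z)"
      by (rule has_field_derivative_transform_within_open[of _ _ _ unit_disc]) (use z f in auto)
    then have "deriv f z = exp (L z) * (1 + z * deriv L z)" by (rule DERIV_imp_deriv)
    moreover have "exp (of_real (\<mu> - 1) * L z) = exp (\<mu> * L z) / exp (L z)"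
      by (simp add: algebra_simps exp_diff)
    ultimately show ?thesis
      by (simp add: N_functional_def branch_powr_def L_def[symmetric] algebra_simps)
  qed
  show ?thesis using that[OF L(1,2) f N] .
qed

text \<open>
  Both \<open>f\<close> and the functional are explicit in the coefficients of \<open>L\<close>; eliminating these expresses
  the functional by the coefficients of \<open>f\<close>. The factor \<open>n * lam + \<mu>\<close> in the \<open>n\<close>-th
  coefficient arises since \<open>\<mu>\<close> times the functional is \<open>\<mu> * E + lam * z * E'\<close> for
  \<open>E = exp (\<mu> * L)\<close>.
\<close>
lemma N_functional_expansion:
  assumes f: "univalent f" "f 0 = 0" "deriv f 0 = 1" and F: "f has_fps_expansion F"
  obtains P where "N_functional \<mu> lam f has_fps_expansion P"
    "P $ 1 = (of_real lam + of_real \<mu>) * F $ 2"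
    "P $ 2 = (2 * of_real lam + of_real \<mu>) * ((of_real \<mu> - 1) / 2 * (F $ 2)\<^sup>2 + F $ 3)"
    "P $ 3 = (3 * of_real lam + of_real \<mu>) * ((of_real \<mu> - 1) * (of_real \<mu> - 2) / 6 * (F $ 2) ^ 3 + (of_real \<mu> - 1) * F $ 2 * F $ 3 + F $ 4)"
proof -
  obtain L :: "complex \<Rightarrow> complex" where L: "L holomorphic_on unit_disc" "L 0 = 0"
    "\<And>z. z \<in> unit_disc \<Longrightarrow> f z = z * exp (L z)"
    "\<And>z. z \<in> unit_disc \<Longrightarrow> N_functional \<mu> lam f z = exp (\<mu> * L z) * (1 + lam * (z * deriv L z))"
    using N_functional_exp_form[OF f, of \<mu> lam] by blast
  define A where "A = fps_expansion L 0"
  have A: "L has_fps_expansion A"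
    unfolding A_def using L(1) by (intro has_fps_expansion_fps_expansion[of unit_disc]) auto
  have A0: "A $ 0 = 0" using has_fps_expansion_imp_0_eq_fps_nth_0[OF A] L(2) by simp
  have e: "(\<lambda>z. exp (m * L z)) has_fps_expansion (fps_exp m oo A)" for m
    using has_fps_expansion_compose[OF has_fps_expansion_exp[of m] A A0] by (simp add: o_def)
  note E = fps_nth_exp_compose[OF A0]
  define P where "P = (fps_exp \<mu> oo A) * (1 + fps_const (of_real lam) * (fps_X * fps_deriv A))"
  have NP: "(\<lambda>z. exp (\<mu> * L z) * (1 + lam * (z * deriv L z))) has_fps_expansion P"
    unfolding P_def by (intro fps_expansion_intros e A)
  have "eventually (\<lambda>z. z \<in> unit_disc) (nhds (0::complex))"
    by (intro eventually_nhds_in_open) auto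
  then have ev: "eventually (\<lambda>z. exp (\<mu> * L z) * (1 + lam * (z * deriv L z)) = N_functional \<mu> lam f z) (nhds 0)"
    by eventually_elim (simp add: L(4))
  have P: "N_functional \<mu> lam f has_fps_expansion P"
    by (rule iffD1[OF has_fps_expansion_cong[OF ev refl] NP])
  have "F = fps_X * (fps_exp 1 oo A)"
    by (rule has_fps_expansion_unique_on_disc[OF F has_fps_expansion_mult[OF has_fps_expansion_fps_X e]])
       (use L(3) in auto)
  then have Fn: "F $ n = (if n = 0 then 0 else (fps_exp 1 oo A) $ (n - 1))" for n by simp
  have F: "F $ 2 = A $ 1" "F $ 3 = A $ 2 + (A $ 1)\<^sup>2 / 2"
    "F $ 4 = A $ 3 + A $ 1 * A $ 2 + (A $ 1) ^ 3 / 6"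
    using E[of 1] Fn[of 2] Fn[of 3] Fn[of 4] by simp_all
  have X: "(fps_X * fps_deriv A) $ n = of_nat n * A $ n" for n
    by (cases n) (simp_all del: of_nat_Suc)
  show ?thesis
  proof (rule that[OF P])
    show "P $ 1 = (of_real lam + of_real \<mu>) * F $ 2" by (simp del: One_nat_def add: P_def fps_mult_nth_1 E F X) (simp add: algebra_simps)
    show "P $ 2 = (2 * of_real lam + of_real \<mu>) * ((of_real \<mu> - 1) / 2 * (F $ 2)\<^sup>2 + F $ 3)"
      by (simp del: One_nat_def add: P_def fps_mult_nth_2 E F X) (simp add: field_simps power2_eq_square)
    show "P $ 3 = (3 * of_real lam + of_real \<mu>) * ((of_real \<mu> - 1) * (of_real \<mu> - 2) / 6 * (F $ 2) ^ 3 + (of_real \<mu> - 1) * F $ 2 * F $ 3 + F $ 4)"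
      by (simp del: One_nat_def add: P_def fps_mult_nth_3 E F X) (simp add: field_simps eval_nat_numeral)
  qed
qed

text \<open>
  Clearing the denominator of \<open>chebyshev_gen t\<close> turns the subordination into
  \<open>N * (1 - 2 * t * w + w\<^sup>2) = 1\<close>, from which the coefficients of \<open>N\<close> can be read off one after the
  other. The constants \<open>2 t\<close>, \<open>4 t\<^sup>2 - 1\<close>, \<open>8 t\<^sup>3 - 4 t\<close> are the values at \<open>t\<close> of the Chebyshev
  polynomials of the second kind.
\<close>
lemma subordinate_chebyshev_coefficients:
  assumes sub: "subordinate N (chebyshev_gen t)" and P: "N has_fps_expansion P"
  obtains c1 c2 c3 where
    "cmod c1 \<le> 1" "cmod c2 \<le> 1 - (cmod c1)\<^sup>2"
    "cmod c3 \<le> 1 - (cmod c1)\<^sup>2 - (cmod c2)\<^sup>2 / (1 + cmod c1)"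
    "P $ 1 = of_real (2 * t) * c1"
    "P $ 2 = of_real (2 * t) * c2 + of_real (4 * t\<^sup>2 - 1) * c1\<^sup>2"
    "P $ 3 = of_real (2 * t) * c3 + 2 * of_real (4 * t\<^sup>2 - 1) * c1 * c2 + of_real (8 * t ^ 3 - 4 * t) * c1 ^ 3"
proof -
  obtain w where w: "w holomorphic_on unit_disc" "w 0 = 0"
    "\<And>z. z \<in> unit_disc \<Longrightarrow> cmod (w z) < 1"
    "\<And>z. z \<in> unit_disc \<Longrightarrow> N z = chebyshev_gen t (w z)"
    using sub by (auto simp: subordinate_def)
  define W where "W = fps_expansion w 0"
  have W: "w has_fps_expansion W"
    unfolding W_def using w(1) by (intro has_fps_expansion_fps_expansion[of unit_disc]) auto
  have W0: "W $ 0 = 0" using has_fps_expansion_imp_0_eq_fps_nth_0[OF W] w(2) by simp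
  define D where "D = (\<lambda>z. 1 - 2 * of_real t * w z + w z ^ 2)"
  have D: "D has_fps_expansion 1 - fps_const (2 * of_real t) * W + W ^ 2"
    unfolding D_def by (intro fps_expansion_intros W)
  have "D 0 \<noteq> 0" by (simp add: D_def w)
  have "(\<lambda>z. N z * D z) has_fps_expansion P * (1 - fps_const (2 * of_real t) * W + W ^ 2)"
    by (intro has_fps_expansion_mult P D)
  moreover have "(\<lambda>z. N z * D z) has_fps_expansion 1"
  proof -
    have "isCont D 0" using has_fps_expansion_imp_continuous[OF D] .
    then have "eventually (\<lambda>z. D z \<noteq> 0) (nhds 0)"
      using \<open>D 0 \<noteq> 0\<close> by (simp add: continuous_at_imp_continuous_within tendsto_imp_eventually_ne isCont_def tendsto_at_iff_tendsto_nhds)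
    moreover have "eventually (\<lambda>z. z \<in> unit_disc) (nhds (0::complex))"
      by (intro eventually_nhds_in_open) auto
    ultimately have "eventually (\<lambda>z. N z * D z = 1) (nhds 0)"
      by eventually_elim (simp add: w(4) chebyshev_gen_def D_def)
    then show ?thesis using has_fps_expansion_cong[of "\<lambda>z. N z * D z" "\<lambda>_. 1" 1 1] by simp
  qed
  ultimately have "P * (1 - fps_const (2 * of_real t) * W + W ^ 2) = 1"
    using fps_expansion_unique_complex by blast
  then have n: "(P * (1 - fps_const (2 * of_real t) * W + W * W)) $ n = (1 :: complex fps) $ n" for n
    by (simp add: power2_eq_square)
  have P0: "P $ 0 = 1" using n[of 0] W0 by simp
  have P1: "P $ 1 = of_real (2 * t) * W $ 1"
    using n[of 1] W0 P0 by (simp add: fps_mult_nth_1)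
  have P2: "P $ 2 = of_real (2 * t) * W $ 2 + of_real (4 * t\<^sup>2 - 1) * (W $ 1)\<^sup>2"
    using n[of 2] unfolding fps_mult_nth_2 by (simp add: fps_mult_nth_2 W0 P0 P1[simplified]) algebra
  have P3: "P $ 3 = of_real (2 * t) * W $ 3 + 2 * of_real (4 * t\<^sup>2 - 1) * W $ 1 * W $ 2 + of_real (8 * t ^ 3 - 4 * t) * (W $ 1) ^ 3"
    using n[of 3] unfolding fps_mult_nth_3 by (simp add: fps_mult_nth_3 fps_mult_nth_2 W0 P0 P1[simplified] P2) algebra
  show ?thesis using that[OF Schwarz_coefficients[OF w(1,2,3) W] P1 P2 P3] .
qed

lemma univalent_inverse_expansion:
  assumes inv: "univalent_inverse f g" and f0: "f 0 = 0" and F: "f has_fps_expansion F"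
  obtains G where "g has_fps_expansion G" "G oo F = fps_X"
proof -
  have F0: "F $ 0 = 0" using has_fps_expansion_imp_0_eq_fps_nth_0[OF F] f0 by simp
  have "g holomorphic_on unit_disc" using inv by (simp add: univalent_inverse_def univalent_def)
  then have G: "g has_fps_expansion fps_expansion g 0"
    by (intro has_fps_expansion_fps_expansion[of unit_disc]) auto
  have "(g \<circ> f) has_fps_expansion (fps_expansion g 0 oo F)"
    by (rule has_fps_expansion_compose[OF G F F0])
  moreover have "(g \<circ> f) has_fps_expansion fps_X"
  proof (rule iffD1[OF has_fps_expansion_cong[OF _ refl] has_fps_expansion_fps_X])
    show "\<forall>\<^sub>F z in nhds 0. z = (g \<circ> f) z"
      using inv by (auto simp: univalent_inverse_def elim: eventually_mono)
  qed
  ultimately have "fps_expansion g 0 oo F = fps_X" using fps_expansion_unique_complex by blast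
  then show ?thesis using that G by blast
qed

lemma inverse_coefficients:
  fixes F G :: "complex fps"
  assumes GF: "G oo F = fps_X" and F: "F $ 0 = 0" "F $ 1 = 1"
  shows "G $ 0 = 0" "G $ 1 = 1" "G $ 2 = - (F $ 2)" "G $ 3 = 2 * (F $ 2)\<^sup>2 - F $ 3"
    "G $ 4 = - (5 * (F $ 2) ^ 3 - 5 * F $ 2 * F $ 3 + F $ 4)"
proof -
  have n: "(\<Sum>i=0..n. G $ i * (F ^ i) $ n) = fps_X $ n" for n
    using arg_cong[OF GF, of "\<lambda>H. H $ n"] by (simp add: fps_compose_nth)
  have F': "F $ Suc 0 = 1" using F(2) by simp
  note e = fps_low_mult power2_eq_square power3_eq_cube power4_eq_xxxx F F'
  show G0: "G $ 0 = 0" using n[of 0] by simp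
  show G1: "G $ 1 = 1" using n[of 1] F' by simp
  have i2: "{0..2::nat} = {0, 1, 2}" and i3: "{0..3::nat} = {0, 1, 2, 3}"
    and i4: "{0..4::nat} = {0, 1, 2, 3, 4}" by auto
  show G2: "G $ 2 = - (F $ 2)" using n[of 2] G0 G1
    by (simp add: i2 e) (simp add: add_eq_0_iff)
  show G3: "G $ 3 = 2 * (F $ 2)\<^sup>2 - F $ 3" using n[of 3] G0 G1 G2
    by (simp add: i3 e) algebra
  show "G $ 4 = - (5 * (F $ 2) ^ 3 - 5 * F $ 2 * F $ 3 + F $ 4)" using n[of 4] G0 G1 G2 G3
    by (simp add: i4 e) algebra
qed

text \<open>
  The first equations of the two triples give \<open>d\<^sub>1 = - c\<^sub>1\<close>. Then \<open>c\<^sub>1\<^sup>2\<close> cancels in the difference of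
  the second equations, which yields \<open>a\<^sub>3 = a\<^sub>2\<^sup>2 + \<delta>\<close> with \<open>\<delta>\<close> proportional to \<open>c\<^sub>2 - d\<^sub>2\<close>, and the
  difference of the third equations yields \<open>a\<^sub>4\<close>. Here \<open>U1\<close>, \<open>U2\<close>, \<open>U3\<close> stand for the coefficients of
  the function to which one subordinates, and \<open>m\<close> for \<open>\<mu>\<close>.
\<close>
lemma Hankel_identity:
  fixes a2 a3 a4 c1 c2 c3 d1 d2 d3 A B C m U1 U2 U3 :: complex
  assumes nz: "A \<noteq> 0" "B \<noteq> 0" "C \<noteq> 0" "U1 \<noteq> 0"
    and 1: "A * a2 = U1 * c1"
    and 2: "B * ((m - 1) / 2 * a2\<^sup>2 + a3) = U1 * c2 + U2 * c1\<^sup>2"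
    and 3: "C * ((m - 1) * (m - 2) / 6 * a2 ^ 3 + (m - 1) * a2 * a3 + a4) = U1 * c3 + 2 * U2 * c1 * c2 + U3 * c1 ^ 3"
    and 4: "A * (- a2) = U1 * d1"
    and 5: "B * ((m - 1) / 2 * (- a2)\<^sup>2 + (2 * a2\<^sup>2 - a3)) = U1 * d2 + U2 * d1\<^sup>2"
    and 6: "C * ((m - 1) * (m - 2) / 6 * (- a2) ^ 3 + (m - 1) * (- a2) * (2 * a2\<^sup>2 - a3)
        + - (5 * a2 ^ 3 - 5 * a2 * a3 + a4)) = U1 * d3 + 2 * U2 * d1 * d2 + U3 * d1 ^ 3"
  shows "d1 = - c1"
    and "a2 * a4 - a3\<^sup>2 = U1\<^sup>2 / (2 * A * C) * c1 * (c3 - d3) + U1 * U2 / (A * C) * c1\<^sup>2 * (c2 + d2)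
      + U1 ^ 3 / (4 * A\<^sup>2 * B) * c1\<^sup>2 * (c2 - d2) - U1\<^sup>2 / (4 * B\<^sup>2) * (c2 - d2)\<^sup>2
      + (U1 * U3 / (A * C) - (m\<^sup>2 + 3 * m + 2) * U1 ^ 4 / (6 * A ^ 4)) * c1 ^ 4"
proof -
  have "U1 * d1 = U1 * (- c1)" using 1 4 by (simp add: algebra_simps)
  then show d1: "d1 = - c1" using nz(4) mult_left_cancel by blast
  define \<delta> where "\<delta> = U1 * (c2 - d2) / (2 * B)"
  have a2: "a2 = U1 * c1 / A" using 1 nz by (simp add: field_simps)
  have "B * (2 * a3 - 2 * a2\<^sup>2) = U1 * (c2 - d2)"
    using 2 5 unfolding d1 by (simp add: algebra_simps) algebra
  then have a3: "a3 = a2\<^sup>2 + \<delta>" using nz by (simp add: \<delta>_def field_simps)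
  define V where "V = U1 * (c3 - d3) + 2 * U2 * c1 * (c2 + d2) + 2 * U3 * c1 ^ 3"
  have "C * (2 * a4 + (m\<^sup>2 + 3 * m - 4) / 3 * a2 ^ 3 - 5 * a2 * \<delta>) = V"
  proof -
    have "V = C * ((m - 1) * (m - 2) / 6 * a2 ^ 3 + (m - 1) * a2 * a3 + a4)
      - C * ((m - 1) * (m - 2) / 6 * (- a2) ^ 3 + (m - 1) * (- a2) * (2 * a2\<^sup>2 - a3)
        + - (5 * a2 ^ 3 - 5 * a2 * a3 + a4))"
      unfolding 3 6 d1 V_def by (simp add: algebra_simps power3_eq_cube)
    also have "\<dots> = C * (2 * a4 + (m\<^sup>2 + 3 * m - 4) / 3 * a2 ^ 3 - 5 * a2 * \<delta>)"
      unfolding a3 by (simp add: field_simps eval_nat_numeral)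
    finally show ?thesis ..
  qed
  then have a4: "a4 = V / (2 * C) - (m\<^sup>2 + 3 * m - 4) / 6 * a2 ^ 3 + 5 / 2 * a2 * \<delta>"
    using nz by (simp add: field_simps)
  have "a2 * a4 - a3\<^sup>2 = a2 * V / (2 * C) - (m\<^sup>2 + 3 * m + 2) / 6 * a2 ^ 4 + a2\<^sup>2 * \<delta> / 2 - \<delta>\<^sup>2"
    unfolding a4 a3 by (simp add: field_simps eval_nat_numeral)
  also have "\<dots> = U1\<^sup>2 / (2 * A * C) * c1 * (c3 - d3) + U1 * U2 / (A * C) * c1\<^sup>2 * (c2 + d2)
      + U1 ^ 3 / (4 * A\<^sup>2 * B) * c1\<^sup>2 * (c2 - d2) - U1\<^sup>2 / (4 * B\<^sup>2) * (c2 - d2)\<^sup>2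
      + (U1 * U3 / (A * C) - (m\<^sup>2 + 3 * m + 2) * U1 ^ 4 / (6 * A ^ 4)) * c1 ^ 4"
    unfolding V_def \<delta>_def a2 using nz by (simp add: field_simps eval_nat_numeral)
  finally show "a2 * a4 - a3\<^sup>2 = \<dots>" .
qed

section \<open>Maximisation\<close>

text \<open>
  For fixed \<open>x\<close> the left-hand side is largest at \<open>p = q = 1 - x\<^sup>2\<close>. The point is that the quadratic
  form in \<open>p\<close> and \<open>q\<close> need not be monotone in each variable, but its bound in terms of \<open>m = p + q\<close>
  has the nonnegative leading coefficient \<open>\<alpha> - \<beta> * x / (2 * (1 + x))\<close>: the hypothesis \<open>\<beta> \<le> 4 * \<alpha>\<close>
  matches \<open>x / (2 * (1 + x)) \<le> 1 / 4\<close>.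
\<close>
lemma Hankel_estimate:
  fixes x p q r s S \<alpha> \<beta> :: real
  assumes x: "0 \<le> x" "x \<le> 1" and pq: "0 \<le> p" "p \<le> 1 - x\<^sup>2" "0 \<le> q" "q \<le> 1 - x\<^sup>2"
    and r: "r \<le> 1 - x\<^sup>2 - p\<^sup>2 / (1 + x)" and s: "s \<le> 1 - x\<^sup>2 - q\<^sup>2 / (1 + x)"
    and c: "0 \<le> S" "0 \<le> \<beta>" "\<beta> \<le> 4 * \<alpha>"
  shows "\<beta> * x * (r + s) + S * x\<^sup>2 * (p + q) + \<alpha> * (p + q)\<^sup>2
    \<le> 2 * (\<beta> + S) * x\<^sup>2 * (1 - x\<^sup>2) + 4 * \<alpha> * (1 - x\<^sup>2)\<^sup>2"
proof -
  define m where "m = p + q"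
  have m: "0 \<le> m" "m \<le> 2 * (1 - x\<^sup>2)" using pq by (auto simp: m_def)
  have "m\<^sup>2 / 2 \<le> p\<^sup>2 + q\<^sup>2"
    using zero_le_power2[of "p - q"] by (simp add: m_def power2_eq_square algebra_simps)
  then have "m\<^sup>2 / 2 / (1 + x) \<le> (p\<^sup>2 + q\<^sup>2) / (1 + x)"
    using x by (intro divide_right_mono) auto
  then have "r + s \<le> 2 * (1 - x\<^sup>2) - m\<^sup>2 / 2 / (1 + x)"
    using r s by (simp add: add_divide_distrib)
  then have "\<beta> * x * (r + s) \<le> \<beta> * x * (2 * (1 - x\<^sup>2) - m\<^sup>2 / 2 / (1 + x))"
    using c x by (intro mult_left_mono) auto
  then have "\<beta> * x * (r + s) + S * x\<^sup>2 * m + \<alpha> * m\<^sup>2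
      \<le> 2 * \<beta> * x * (1 - x\<^sup>2) + S * x\<^sup>2 * m + (\<alpha> - \<beta> * x / (2 * (1 + x))) * m\<^sup>2"
    by (simp add: algebra_simps)
  also have "\<dots> \<le> 2 * \<beta> * x * (1 - x\<^sup>2) + S * x\<^sup>2 * (2 * (1 - x\<^sup>2))
      + (\<alpha> - \<beta> * x / (2 * (1 + x))) * (2 * (1 - x\<^sup>2))\<^sup>2"
  proof -
    have "x / (2 * (1 + x)) \<le> 1 / 4" using x by (simp add: field_simps)
    then have "\<beta> * (x / (2 * (1 + x))) \<le> \<beta> * (1 / 4)" using c by (intro mult_left_mono) auto
    then have "\<beta> * x / (2 * (1 + x)) \<le> \<beta> / 4"
      by (simp only: times_divide_eq_right mult_1_right)
    then have "0 \<le> \<alpha> - \<beta> * x / (2 * (1 + x))" using c by linarith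
    then show ?thesis using m c x by (intro add_mono mult_left_mono power_mono order_refl) auto
  qed
  also have "\<dots> = 2 * (\<beta> + S) * x\<^sup>2 * (1 - x\<^sup>2) + 4 * \<alpha> * (1 - x\<^sup>2)\<^sup>2"
  proof -
    have "1 + x \<noteq> 0" using x by simp
    then have "\<beta> * x / (2 * (1 + x)) * (2 * (1 - x\<^sup>2))\<^sup>2 = 2 * \<beta> * x * (1 - x\<^sup>2) * (1 - x)"
      by (simp add: divide_simps) (simp add: algebra_simps power2_eq_square)
    then show ?thesis by (simp add: algebra_simps power2_eq_square)
  qed
  finally show ?thesis by (simp add: m_def)
qed

text \<open>
  The quadratic in \<open>y = x\<^sup>2\<close> provided by the estimate, rewritten with \<open>M1\<close> and \<open>M2\<close>. The term
  with \<open>lam\<^sup>2\<close> in \<open>M1\<close> comes from \<open>4 t\<^sup>2 / B\<^sup>2 - 4 t\<^sup>2 / (A C)\<close>, because \<open>A C = B\<^sup>2 - lam\<^sup>2\<close>.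
\<close>
lemma Hankel_majorant_eq:
  fixes lam \<mu> t y :: real
  assumes "lam \<ge> 1" "\<mu> \<ge> 0"
  defines "A \<equiv> lam + \<mu>" and "B \<equiv> 2 * lam + \<mu>" and "C \<equiv> 3 * lam + \<mu>"
  shows "8 * t\<^sup>2 / (3 * A ^ 4 * C) * \<bar>3 * (2 * t\<^sup>2 - 1) * A ^ 3 - (\<mu>\<^sup>2 + 3 * \<mu> + 2) * C * t\<^sup>2\<bar> * y\<^sup>2
     + 2 * (2 * t\<^sup>2 / (A * C) + (2 * t * (4 * t\<^sup>2 - 1) / (A * C) + 2 * t ^ 3 / (A\<^sup>2 * B))) * y * (1 - y)
     + 4 * (t\<^sup>2 / B\<^sup>2) * (1 - y)\<^sup>2
   = 4 * t\<^sup>2 / B\<^sup>2 + (M1 \<mu> lam t * y\<^sup>2 + 3 * M2 \<mu> lam t * y) / (6 * A ^ 4 * B\<^sup>2 * C)"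
proof -
  define T where "T = \<bar>3 * (2 * t\<^sup>2 - 1) * A ^ 3 - (\<mu>\<^sup>2 + 3 * \<mu> + 2) * C * t\<^sup>2\<bar>"
  have nz: "A \<noteq> 0" "B \<noteq> 0" "C \<noteq> 0" using assms by auto
  have lam2: "lam\<^sup>2 = B\<^sup>2 - A * C" by (simp add: A_def B_def C_def power2_eq_square algebra_simps)
  have M1: "M1 \<mu> lam t = 16 * t\<^sup>2 * T * B\<^sup>2
     - 24 * t * (t\<^sup>2 * C + (4 * t\<^sup>2 - 1) * A * B) * A\<^sup>2 * B - 24 * t\<^sup>2 * (B\<^sup>2 - A * C) * A ^ 3"
    unfolding M1_def T_def A_def[symmetric] B_def[symmetric] C_def[symmetric] lam2 ..
  have M2: "M2 \<mu> lam t = 8 * t * (t\<^sup>2 * B * C + (4 * t\<^sup>2 - 1) * A * B\<^sup>2 + t * B\<^sup>2 * A - 2 * t * A\<^sup>2 * C) * A\<^sup>2"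
    unfolding M2_def A_def[symmetric] B_def[symmetric] C_def[symmetric] ..
  show ?thesis unfolding T_def[symmetric] M1 M2
    using nz by (simp add: divide_simps) (simp add: algebra_simps eval_nat_numeral)
qed

text \<open>Completing the square: the vertex lies at \<open>y = - 3 * n / (2 * m)\<close>.\<close>
lemma quadratic_le_vertex:
  fixes m n y :: real
  assumes "m < 0"
  shows "m * y\<^sup>2 + 3 * n * y \<le> - 9 * n\<^sup>2 / (4 * m)"
proof -
  have "m * y\<^sup>2 + 3 * n * y + 9 * n\<^sup>2 / (4 * m) = m * (y + 3 * n / (2 * m))\<^sup>2"
    using assms by (simp add: field_simps power2_eq_square)
  also have "\<dots> \<le> 0" using assms by (simp add: mult_nonpos_nonneg)
  finally show ?thesis by simp
qed

section \<open>The second Hankel determinant\<close>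

text \<open>
  The number \<open>y\<close> is \<open>|c\<^sub>1|\<^sup>2\<close> for the Schwarz function belonging to \<open>f\<close>. In the polynomial for the
  determinant the signs of all coefficients are known, those with the factor \<open>4 t\<^sup>2 - 1\<close> because
  \<open>t > 1/2\<close>; the exception is the coefficient of \<open>c\<^sub>1\<^sup>4\<close>, which is where the absolute value in
  \<open>M1\<close> comes from.
\<close>
lemma Hankel_majorant:
  fixes lam \<mu> t :: real and f :: "complex \<Rightarrow> complex"
  assumes lam: "lam \<ge> 1" and \<mu>: "\<mu> \<ge> 0" and t: "1/2 < t"
    and f: "f \<in> N_class \<mu> lam t" and F: "f has_fps_expansion F"
  obtains y where "0 \<le> y" "y \<le> 1"
    "cmod (F $ 2 * F $ 4 - (F $ 3)\<^sup>2) \<le> 4 * t\<^sup>2 / (2 * lam + \<mu>)\<^sup>2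
      + (M1 \<mu> lam t * y\<^sup>2 + 3 * M2 \<mu> lam t * y)
        / (6 * (lam + \<mu>) ^ 4 * (2 * lam + \<mu>)\<^sup>2 * (3 * lam + \<mu>))"
proof -
  obtain g where uni: "univalent f" "f 0 = 0" "deriv f 0 = 1" and inv: "univalent_inverse f g"
    and sub: "subordinate (N_functional \<mu> lam f) (chebyshev_gen t)"
      "subordinate (N_functional \<mu> lam g) (chebyshev_gen t)"
    using f by (auto simp: N_class_def bi_univalent_def)
  have F0: "F $ 0 = 0" using has_fps_expansion_imp_0_eq_fps_nth_0[OF F] uni(2) by simp
  have F1: "F $ 1 = 1" using fps_nth_fps_expansion[OF F, of 1] uni(3) by simp
  obtain G where G: "g has_fps_expansion G" and GF: "G oo F = fps_X"
    using univalent_inverse_expansion[OF inv uni(2) F] by blast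
  note Gn = inverse_coefficients[OF GF F0 F1]
  have g: "univalent g" "g 0 = 0" "deriv g 0 = 1"
    using inv has_fps_expansion_imp_0_eq_fps_nth_0[OF G] fps_nth_fps_expansion[OF G, of 1] Gn(1,2)
    by (simp_all add: univalent_inverse_def)
  obtain P where P: "N_functional \<mu> lam f has_fps_expansion P"
    "P $ 1 = (of_real lam + of_real \<mu>) * F $ 2"
    "P $ 2 = (2 * of_real lam + of_real \<mu>) * ((of_real \<mu> - 1) / 2 * (F $ 2)\<^sup>2 + F $ 3)"
    "P $ 3 = (3 * of_real lam + of_real \<mu>) * ((of_real \<mu> - 1) * (of_real \<mu> - 2) / 6 * (F $ 2) ^ 3
      + (of_real \<mu> - 1) * F $ 2 * F $ 3 + F $ 4)"
    by (rule N_functional_expansion[OF uni F])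
  obtain Q where Q: "N_functional \<mu> lam g has_fps_expansion Q"
    "Q $ 1 = (of_real lam + of_real \<mu>) * G $ 2"
    "Q $ 2 = (2 * of_real lam + of_real \<mu>) * ((of_real \<mu> - 1) / 2 * (G $ 2)\<^sup>2 + G $ 3)"
    "Q $ 3 = (3 * of_real lam + of_real \<mu>) * ((of_real \<mu> - 1) * (of_real \<mu> - 2) / 6 * (G $ 2) ^ 3
      + (of_real \<mu> - 1) * G $ 2 * G $ 3 + G $ 4)"
    by (rule N_functional_expansion[OF g G])
  obtain c1 c2 c3 where c: "cmod c1 \<le> 1" "cmod c2 \<le> 1 - (cmod c1)\<^sup>2"
    "cmod c3 \<le> 1 - (cmod c1)\<^sup>2 - (cmod c2)\<^sup>2 / (1 + cmod c1)"
    "P $ 1 = of_real (2 * t) * c1"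
    "P $ 2 = of_real (2 * t) * c2 + of_real (4 * t\<^sup>2 - 1) * c1\<^sup>2"
    "P $ 3 = of_real (2 * t) * c3 + 2 * of_real (4 * t\<^sup>2 - 1) * c1 * c2 + of_real (8 * t ^ 3 - 4 * t) * c1 ^ 3"
    by (rule subordinate_chebyshev_coefficients[OF sub(1) P(1)])
  obtain d1 d2 d3 where d: "cmod d1 \<le> 1" "cmod d2 \<le> 1 - (cmod d1)\<^sup>2"
    "cmod d3 \<le> 1 - (cmod d1)\<^sup>2 - (cmod d2)\<^sup>2 / (1 + cmod d1)"
    "Q $ 1 = of_real (2 * t) * d1"
    "Q $ 2 = of_real (2 * t) * d2 + of_real (4 * t\<^sup>2 - 1) * d1\<^sup>2"
    "Q $ 3 = of_real (2 * t) * d3 + 2 * of_real (4 * t\<^sup>2 - 1) * d1 * d2 + of_real (8 * t ^ 3 - 4 * t) * d1 ^ 3"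
    by (rule subordinate_chebyshev_coefficients[OF sub(2) Q(1)])
  define A B C where "A = lam + \<mu>" and "B = 2 * lam + \<mu>" and "C = 3 * lam + \<mu>"
  have pos: "0 < A" "0 < B" "0 < C" using lam \<mu> by (auto simp: A_def B_def C_def)
  have ABC: "complex_of_real lam + of_real \<mu> = of_real A" "2 * complex_of_real lam + of_real \<mu> = of_real B"
    "3 * complex_of_real lam + of_real \<mu> = of_real C" by (simp_all add: A_def B_def C_def)
  have nz: "complex_of_real A \<noteq> 0" "complex_of_real B \<noteq> 0" "complex_of_real C \<noteq> 0" "complex_of_real (2 * t) \<noteq> 0"
    using pos t by auto
  note eqs = trans[OF P(2)[symmetric] c(4)] trans[OF P(3)[symmetric] c(5)] trans[OF P(4)[symmetric] c(6)]
    trans[OF Q(2)[symmetric] d(4)] trans[OF Q(3)[symmetric] d(5)] trans[OF Q(4)[symmetric] d(6)]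
  note H = Hankel_identity[OF nz eqs[unfolded Gn ABC]]
  define x where "x = cmod c1"
  have dx: "cmod d1 = x" by (simp add: H(1) x_def)
  define p q r s where "p = cmod c2" and "q = cmod d2" and "r = cmod c3" and "s = cmod d3"
  define T where "T = 3 * (2 * t\<^sup>2 - 1) * A ^ 3 - (\<mu>\<^sup>2 + 3 * \<mu> + 2) * C * t\<^sup>2"
  define \<alpha> \<beta> S1 S2 where "\<alpha> = t\<^sup>2 / B\<^sup>2" and "\<beta> = 2 * t\<^sup>2 / (A * C)"
    and "S1 = 2 * t * (4 * t\<^sup>2 - 1) / (A * C)" and "S2 = 2 * t ^ 3 / (A\<^sup>2 * B)"
  define \<tau> where "\<tau> = 8 * t\<^sup>2 / (3 * A ^ 4 * C)"
  have "(1/2)\<^sup>2 < t\<^sup>2" using t by (intro power_strict_mono) auto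
  then have t2: "0 < 4 * t\<^sup>2 - 1" by (simp add: power2_eq_square)
  have nn: "0 \<le> \<alpha>" "0 \<le> \<beta>" "0 \<le> S1" "0 \<le> S2" "0 \<le> \<tau>"
    unfolding \<alpha>_def \<beta>_def S1_def S2_def \<tau>_def using pos t t2
    by (auto intro!: divide_nonneg_pos mult_nonneg_nonneg)
  have "F $ 2 * F $ 4 - (F $ 3)\<^sup>2 = of_real \<beta> * c1 * (c3 - d3) + of_real S1 * c1\<^sup>2 * (c2 + d2)
      + of_real S2 * c1\<^sup>2 * (c2 - d2) - of_real \<alpha> * (c2 - d2)\<^sup>2 + of_real (\<tau> * T) * c1 ^ 4"
  proof -
    have "of_real (2 * t) * of_real (8 * t ^ 3 - 4 * t) / (of_real A * of_real C)
        - ((of_real \<mu>)\<^sup>2 + 3 * of_real \<mu> + 2) * of_real (2 * t) ^ 4 / (6 * of_real A ^ 4)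
      = complex_of_real (2 * t * (8 * t ^ 3 - 4 * t) / (A * C) - (\<mu>\<^sup>2 + 3 * \<mu> + 2) * (2 * t) ^ 4 / (6 * A ^ 4))"
      by simp
    also have "2 * t * (8 * t ^ 3 - 4 * t) / (A * C) - (\<mu>\<^sup>2 + 3 * \<mu> + 2) * (2 * t) ^ 4 / (6 * A ^ 4) = \<tau> * T"
      unfolding \<tau>_def T_def using pos by (simp add: divide_simps) (simp add: algebra_simps eval_nat_numeral)
    finally show ?thesis unfolding H(2) \<beta>_def S1_def S2_def \<alpha>_def
      by (simp add: power_mult_distrib power2_eq_square power3_eq_cube mult.assoc)
  qed
  also have "cmod \<dots> \<le> cmod (of_real \<beta> * c1 * (c3 - d3)) + cmod (of_real S1 * c1\<^sup>2 * (c2 + d2))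
      + cmod (of_real S2 * c1\<^sup>2 * (c2 - d2)) + cmod (of_real \<alpha> * (c2 - d2)\<^sup>2) + cmod (of_real (\<tau> * T) * c1 ^ 4)"
    by (intro order_trans[OF norm_triangle_ineq] order_trans[OF norm_triangle_ineq4] add_mono order_refl)
  also have "\<dots> = \<beta> * x * cmod (c3 - d3) + S1 * x\<^sup>2 * cmod (c2 + d2) + S2 * x\<^sup>2 * cmod (c2 - d2)
      + \<alpha> * (cmod (c2 - d2))\<^sup>2 + \<tau> * \<bar>T\<bar> * x ^ 4"
    using nn by (simp add: norm_mult norm_power x_def abs_mult)
  also have "\<dots> \<le> \<beta> * x * (r + s) + S1 * x\<^sup>2 * (p + q) + S2 * x\<^sup>2 * (p + q) + \<alpha> * (p + q)\<^sup>2 + \<tau> * \<bar>T\<bar> * x ^ 4"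
    unfolding p_def q_def r_def s_def using nn
    by (intro add_mono mult_left_mono power_mono order_refl norm_triangle_ineq norm_triangle_ineq4 mult_nonneg_nonneg)
       (auto simp: x_def)
  also have "\<dots> = (\<beta> * x * (r + s) + (S1 + S2) * x\<^sup>2 * (p + q) + \<alpha> * (p + q)\<^sup>2) + \<tau> * \<bar>T\<bar> * x ^ 4"
    by (simp add: algebra_simps)
  also have "\<dots> \<le> (2 * (\<beta> + (S1 + S2)) * x\<^sup>2 * (1 - x\<^sup>2) + 4 * \<alpha> * (1 - x\<^sup>2)\<^sup>2) + \<tau> * \<bar>T\<bar> * x ^ 4"
  proof (intro add_right_mono Hankel_estimate)
    \<comment> \<open>This is \<open>B\<^sup>2 \<le> 2 A C\<close>, which holds because \<open>2 A C - B\<^sup>2 = B\<^sup>2 - 2 lam\<^sup>2\<close> and \<open>B \<ge> 2 lam\<close>.\<close>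
    show "\<beta> \<le> 4 * \<alpha>"
    proof -
      have "B\<^sup>2 \<le> 2 * (A * C)" unfolding A_def B_def C_def using lam \<mu>
        by (simp add: power2_eq_square algebra_simps)
      then have "2 * (t\<^sup>2 * B\<^sup>2) \<le> 2 * (t\<^sup>2 * (2 * (A * C)))" by (intro mult_left_mono) auto
      then show ?thesis unfolding \<alpha>_def \<beta>_def using pos by (simp add: divide_simps)
    qed
    show "r \<le> 1 - x\<^sup>2 - p\<^sup>2 / (1 + x)" "s \<le> 1 - x\<^sup>2 - q\<^sup>2 / (1 + x)" "p \<le> 1 - x\<^sup>2" "q \<le> 1 - x\<^sup>2" "x \<le> 1"
      using c(1-3) d(1-3) unfolding dx unfolding x_def p_def q_def r_def s_def by auto
  qed (use nn in \<open>auto simp: x_def p_def q_def\<close>)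
  also have "\<dots> = \<tau> * \<bar>T\<bar> * (x\<^sup>2)\<^sup>2 + 2 * (\<beta> + (S1 + S2)) * x\<^sup>2 * (1 - x\<^sup>2) + 4 * \<alpha> * (1 - x\<^sup>2)\<^sup>2"
    by simp
  also have "\<dots> = 4 * t\<^sup>2 / B\<^sup>2 + (M1 \<mu> lam t * (x\<^sup>2)\<^sup>2 + 3 * M2 \<mu> lam t * x\<^sup>2) / (6 * A ^ 4 * B\<^sup>2 * C)"
    using Hankel_majorant_eq[OF lam \<mu>, of t "x\<^sup>2"]
    unfolding \<tau>_def T_def \<alpha>_def \<beta>_def S1_def S2_def A_def B_def C_def by simp
  finally have "cmod (F $ 2 * F $ 4 - (F $ 3)\<^sup>2)
    \<le> 4 * t\<^sup>2 / B\<^sup>2 + (M1 \<mu> lam t * (x\<^sup>2)\<^sup>2 + 3 * M2 \<mu> lam t * x\<^sup>2) / (6 * A ^ 4 * B\<^sup>2 * C)" .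
  moreover have "x\<^sup>2 \<le> 1" using c(1) by (simp add: x_def abs_square_le_1)
  ultimately show ?thesis using that[of "x\<^sup>2"] unfolding A_def B_def C_def by simp
qed

theorem theorem1:
  fixes lam \<mu> t :: real and f :: "complex \<Rightarrow> complex" and a :: "nat \<Rightarrow> complex"
  assumes "lam \<ge> 1" and "\<mu> \<ge> 0" and "1/2 < t" and "t \<le> 1"
    and "f \<in> bi_univalent"
    and "\<And>z. z \<in> unit_disc \<Longrightarrow> (\<lambda>n. a (n + 2) * z ^ (n + 2)) sums (f z - z)"
    and "f \<in> N_class \<mu> lam t"
  shows "(M1 \<mu> lam t \<ge> 0 \<and> M2 \<mu> lam t \<ge> 0 \<longrightarrow>
            cmod (a 2 * a 4 - (a 3)\<^sup>2) \<le> K_two \<mu> lam t)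
       \<and> (M1 \<mu> lam t > 0 \<and> M2 \<mu> lam t < 0 \<longrightarrow>
            cmod (a 2 * a 4 - (a 3)\<^sup>2) \<le> max (4 * t\<^sup>2 / (2 * lam + \<mu>)\<^sup>2) (K_two \<mu> lam t))
       \<and> (M1 \<mu> lam t \<le> 0 \<and> M2 \<mu> lam t \<le> 0 \<longrightarrow>
            cmod (a 2 * a 4 - (a 3)\<^sup>2) \<le> 4 * t\<^sup>2 / (2 * lam + \<mu>)\<^sup>2)
       \<and> (M1 \<mu> lam t < 0 \<and> M2 \<mu> lam t > 0 \<longrightarrow>
            cmod (a 2 * a 4 - (a 3)\<^sup>2) \<le> max (K_c0 \<mu> lam t) (K_two \<mu> lam t))"
proof -
  define F where "F = Abs_fps (\<lambda>n. if n = 0 then 0 else if n = 1 then 1 else a n)"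
  have "f has_fps_expansion F"
  proof (rule has_fps_expansionI)
    have "(\<lambda>n. F $ n * z ^ n) sums f z" if "z \<in> unit_disc" for z
    proof -
      have "(\<lambda>n. F $ (n + 2) * z ^ (n + 2)) sums (f z - (\<Sum>n<2. F $ n * z ^ n))"
        using assms(6)[OF that] by (simp add: F_def eval_nat_numeral)
      then show ?thesis by (rule iffD1[OF sums_iff_shift'])
    qed
    moreover have "eventually (\<lambda>z. z \<in> unit_disc) (nhds (0::complex))"
      by (intro eventually_nhds_in_open) auto
    ultimately show "eventually (\<lambda>z. (\<lambda>n. F $ n * z ^ n) sums f z) (nhds 0)"
      by (auto elim: eventually_mono)
  qed
  then obtain y where y: "0 \<le> y" "y \<le> 1" and
    bound: "cmod (F $ 2 * F $ 4 - (F $ 3)\<^sup>2) \<le> 4 * t\<^sup>2 / (2 * lam + \<mu>)\<^sup>2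
      + (M1 \<mu> lam t * y\<^sup>2 + 3 * M2 \<mu> lam t * y)
        / (6 * (lam + \<mu>) ^ 4 * (2 * lam + \<mu>)\<^sup>2 * (3 * lam + \<mu>))"
    using Hankel_majorant[OF assms(1-3,7)] by metis
  define D where "D = 6 * (lam + \<mu>) ^ 4 * (2 * lam + \<mu>)\<^sup>2 * (3 * lam + \<mu>)"
  define m n k where "m = M1 \<mu> lam t" and "n = M2 \<mu> lam t" and "k = 4 * t\<^sup>2 / (2 * lam + \<mu>)\<^sup>2"
  have D: "0 < D" using assms(1,2) by (auto simp: D_def intro!: mult_pos_pos)
  have K2: "K_two \<mu> lam t = k + (m + 3 * n) / D" by (simp add: K_two_def D_def m_def n_def k_def)
  have K0: "K_c0 \<mu> lam t = k + (- 9 * n\<^sup>2 / (4 * m)) / D"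
    by (simp add: K_c0_def D_def m_def n_def k_def)
  have le: "cmod (a 2 * a 4 - (a 3)\<^sup>2) \<le> k + v / D" if "m * y\<^sup>2 + 3 * n * y \<le> v" for v
  proof -
    have "cmod (a 2 * a 4 - (a 3)\<^sup>2) \<le> k + (m * y\<^sup>2 + 3 * n * y) / D"
      using bound by (simp add: F_def D_def m_def n_def k_def)
    also have "\<dots> \<le> k + v / D" using that D by (intro add_left_mono divide_right_mono) auto
    finally show ?thesis .
  qed
  have y2: "0 \<le> y\<^sup>2" "y\<^sup>2 \<le> y" using y by (auto simp: power2_eq_square mult_left_le)
  show ?thesis unfolding K2 K0 m_def[symmetric] n_def[symmetric] k_def[symmetric]
  proof (intro conjI impI; elim conjE)
    assume "0 \<le> m" "0 \<le> n"
    then have "m * y\<^sup>2 \<le> m * 1" "3 * n * y \<le> 3 * n * 1" using y y2 by (intro mult_left_mono; simp)+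
    then show "cmod (a 2 * a 4 - (a 3)\<^sup>2) \<le> k + (m + 3 * n) / D" by (intro le) simp
  next
    \<comment> \<open>Convexity: the quadratic lies below its chord on \<open>[0, 1]\<close>.\<close>
    assume mn: "0 < m" "n < 0"
    then have "m * y\<^sup>2 \<le> m * y" using y2 by (intro mult_left_mono) auto
    then have "m * y\<^sup>2 + 3 * n * y \<le> (m + 3 * n) * y" by (simp add: algebra_simps)
    also have "\<dots> \<le> max 0 (m + 3 * n)"
    proof (cases "0 \<le> m + 3 * n")
      case True
      then have "(m + 3 * n) * y \<le> (m + 3 * n) * 1" using y by (intro mult_left_mono) auto
      then show ?thesis by simp
    next
      case False
      then show ?thesis using y by (simp add: mult_nonpos_nonneg le_max_iff_disj)
    qed
    finally have "cmod (a 2 * a 4 - (a 3)\<^sup>2) \<le> k + max 0 (m + 3 * n) / D" by (rule le)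
    then show "cmod (a 2 * a 4 - (a 3)\<^sup>2) \<le> max k (k + (m + 3 * n) / D)"
      by (cases "0 \<le> m + 3 * n") (auto simp: max_def)
  next
    assume "m \<le> 0" "n \<le> 0"
    then have "m * y\<^sup>2 \<le> 0" "3 * n * y \<le> 0" using y by (auto simp: mult_nonpos_nonneg)
    then show "cmod (a 2 * a 4 - (a 3)\<^sup>2) \<le> k" using le[of 0] by simp
  next
    \<comment> \<open>The vertex bounds the quadratic on the whole line, also when it lies outside \<open>[0, 1]\<close>.\<close>
    assume "m < 0"
    then have "cmod (a 2 * a 4 - (a 3)\<^sup>2) \<le> k + (- 9 * n\<^sup>2 / (4 * m)) / D"
      by (intro le quadratic_le_vertex)
    then show "cmod (a 2 * a 4 - (a 3)\<^sup>2) \<le> max (k + (- 9 * n\<^sup>2 / (4 * m)) / D) (k + (m + 3 * n) / D)"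
      by simp
  qed
qed

end
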